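(* (Mazur's Lemma) Let $(H,d)$ be a Hadamard space and let $(x_n)\subseteq H$ be a sequence such that $x_n\overset{w}\to x$ for some $x\in H$. Then there exist a function $N:\mathbb{N}\to\mathbb{N}$ and a sequence $(y_n)\subseteq H$ such that $y_n\to x$ in the metric $d$ and $y_n\in \operatorname{co}(\{x_1,x_2,\dots,x_{N(n)}\})$ for all $n\in\mathbb{N}$.
   Context: A Hadamard space is a complete $\mathrm{CAT}(0)$ space. For $x\in H$, $\Gamma_x(H)$ is the set of all constant speed geodesics $\gamma:[0,1]\to H$ (i.e. $d(\gamma(s),\gamma(t))=|s-t|\,d(\gamma(0),\gamma(1))$ for all $s,t\in[0,1]$) with $\gamma(0)=x$. For a geodesic $\gamma$, $P_\gamma$ denotes the metric projection onto (the image of) $\gamma$. Weak convergence: $x_n\overset{w}\to x$ means $P_\gamma x_n\to x$ in the metric $d$ for every $\gamma\in\Gamma_x(H)$ (no boundedness of $(x_n)$ is required). A set $C\subseteq H$ is convex if for all $x,y\in C$ the geodesic segment $[x,y]$ is contained in $C$; $\operatorname{co}(C)$ denotes the (geodesic) convex hull, i.e. the smallest convex subset of $H$ containing $C$. *)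

theory Defs
  imports "HOL-Analysis.Analysis"
begin

text \<open>Maps on the unit interval are total functions on \<^typ>\<open>real\<close>; only their values on
  \<^term>\<open>{0..1::real}\<close> are ever used.\<close>

definition (in metric_space) geodesic :: "(real \<Rightarrow> 'a) \<Rightarrow> bool" where
  "geodesic \<gamma> \<longleftrightarrow>
     (\<forall>s\<in>{0..1}. \<forall>t\<in>{0..1}. dist (\<gamma> s) (\<gamma> t) = \<bar>s - t\<bar> * dist (\<gamma> 0) (\<gamma> 1))"

definition (in metric_space) geodesic_from_to :: "'a \<Rightarrow> 'a \<Rightarrow> (real \<Rightarrow> 'a) \<Rightarrow> bool" where
  "geodesic_from_to p q \<gamma> \<longleftrightarrow> geodesic \<gamma> \<and> \<gamma> 0 = p \<and> \<gamma> 1 = q"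

text \<open>Points of one side of a triangle, each paired with its comparison point on the segment from
  \<open>a\<close> to \<open>b\<close> in the Euclidean plane.\<close>

definition comparison_pairs ::
    "(real \<Rightarrow> 'a) \<Rightarrow> real^2 \<Rightarrow> real^2 \<Rightarrow> ('a \<times> (real^2)) set" where
  "comparison_pairs \<gamma> a b = (\<lambda>t. (\<gamma> t, (1 - t) *\<^sub>R a + t *\<^sub>R b)) ` {0..1}"

class cat0_space = metric_space +
  assumes geodesic_exists: "\<exists>\<gamma>. geodesic_from_to p q \<gamma>"
    and cat0_comparison:
      "\<lbrakk>geodesic_from_to p q \<alpha>; geodesic_from_to q r \<beta>; geodesic_from_to r p \<gamma>;
        dist p q = dist a b; dist q r = dist b c; dist r p = dist c a;
        T = comparison_pairs \<alpha> a b \<union> comparison_pairs \<beta> b c \<union> comparison_pairs \<gamma> c a;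
        (u, u') \<in> T; (v, v') \<in> T\<rbrakk>
       \<Longrightarrow> dist u v \<le> dist u' v'"

class hadamard_space = cat0_space + complete_space

definition geodesics_from :: "'a::metric_space \<Rightarrow> (real \<Rightarrow> 'a) set" where
  "geodesics_from x = {\<gamma>. geodesic \<gamma> \<and> \<gamma> 0 = x}"

text \<open>The nearest point is unique when \<open>S\<close> is the image of a geodesic in a Hadamard space.\<close>

definition metric_proj :: "'a::metric_space set \<Rightarrow> 'a \<Rightarrow> 'a" where
  "metric_proj S y = (THE p. p \<in> S \<and> (\<forall>q\<in>S. dist y p \<le> dist y q))"

definition weakly_converges :: "(nat \<Rightarrow> 'a::metric_space) \<Rightarrow> 'a \<Rightarrow> bool" where
  "weakly_converges x l \<longleftrightarrow>
     (\<forall>\<gamma>\<in>geodesics_from l. (\<lambda>n. metric_proj (\<gamma> ` {0..1}) (x n)) \<longlonglongrightarrow> l)"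

text \<open>Geodesics between two given points of a CAT(0) space agree on the unit interval, so that
  quantifying over all of them amounts to speaking of the segment.\<close>

definition geodesically_convex :: "'a::metric_space set \<Rightarrow> bool" where
  "geodesically_convex C \<longleftrightarrow>
     (\<forall>p\<in>C. \<forall>q\<in>C. \<forall>\<gamma>. geodesic_from_to p q \<gamma> \<longrightarrow> \<gamma> ` {0..1} \<subseteq> C)"

end

theory Submission
  imports Defs
begin

text \<open>The hulls \<open>K\<^sub>n\<close> of the first \<open>n\<close> terms increase, so their union \<open>C\<close> is convex, and the
  theorem says exactly that \<open>l\<close> lies in the closure of \<open>C\<close>. Completeness and the
  CAT(0) inequality give a point \<open>p\<close> of that closure nearest to \<open>l\<close>
  (\<open>nearest_point_of_closure_exists\<close>). By the triangle inequality, \<open>p\<close> is also nearest to every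
  point \<open>z\<close> of a geodesic \<open>\<gamma>\<close> from \<open>l\<close> to \<open>p\<close>, and a nearest point of a convex set sees the set
  under an obtuse angle (\<open>nearest_point_obtuse_angle\<close>):
  \<open>d(z, y)\<^sup>2 \<ge> d(z, p)\<^sup>2 + d(p, y)\<^sup>2\<close> for every \<open>y\<close> in \<open>C\<close>. Read from the side of \<open>y\<close>, this inequality
  makes \<open>p\<close> the strictly nearest point of \<open>\<gamma>\<close> to \<open>y\<close>. So every term of the sequence
  projects to \<open>p\<close> on \<open>\<gamma>\<close>, while weak convergence sends these projections to \<open>l\<close>; hence
  \<open>p = l\<close>.

  In Hilbert space one would separate \<open>l\<close> from \<open>C\<close> by a hyperplane. Here the fibre over \<open>p\<close> of the
  projection onto \<open>\<gamma>\<close> takes its place.\<close>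

section \<open>The CAT(0) inequality for a geodesic and a point\<close>

lemma euclidean_comparison_triangle:
  fixes A B D :: real
  assumes nonneg: "0 \<le> A" "0 \<le> B" "0 \<le> D"
    and tri: "A \<le> B + D" "B \<le> A + D" "D \<le> A + B"
  obtains a b c :: "real^2" where "dist a b = D" "dist b c = B" "dist c a = A"
proof -
  \<comment> \<open>Place \<open>a\<close> at the origin and \<open>b\<close> on the first axis; the law of cosines then fixes the
    abscissa of \<open>c\<close>. For \<open>D = 0\<close> the division yields \<open>u = 0\<close>, which is again a correct choice.\<close>
  define u where "u = (A\<^sup>2 + D\<^sup>2 - B\<^sup>2) / (2 * D)"
  define v where "v = sqrt (A\<^sup>2 - u\<^sup>2)"
  have uD: "2 * D * u = A\<^sup>2 + D\<^sup>2 - B\<^sup>2"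
    using nonneg tri by (cases "D = 0") (auto simp: u_def)
  have "\<bar>u\<bar> \<le> A"
  proof (cases "D = 0")
    case True
    then show ?thesis using nonneg by (simp add: u_def)
  next
    case False
    then have D: "0 < D" using nonneg by simp
    have "B\<^sup>2 \<le> (A + D)\<^sup>2" using nonneg tri by (intro power_mono) auto
    then have lower: "2 * D * (- A) \<le> 2 * D * u"
      unfolding uD by (simp add: power2_sum algebra_simps)
    have "\<bar>A - D\<bar> \<le> \<bar>B\<bar>" using nonneg tri by linarith
    then have "(A - D)\<^sup>2 \<le> B\<^sup>2" by (simp only: abs_le_square_iff)
    then have upper: "2 * D * u \<le> 2 * D * A"
      unfolding uD by (simp add: power2_diff algebra_simps)
    have "0 < 2 * D" using D by simp
    then have "- A \<le> u" "u \<le> A" using lower upper by (simp_all only: mult_le_cancel_left_pos)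
    then show ?thesis by (simp add: abs_le_iff)
  qed
  then have "u\<^sup>2 \<le> A\<^sup>2" using nonneg by (simp add: abs_le_square_iff[symmetric])
  then have v: "v\<^sup>2 = A\<^sup>2 - u\<^sup>2" by (simp add: v_def)
  define a b c :: "real^2"
    where "a = vector [0, 0]" and "b = vector [D, 0]" and "c = vector [u, v]"
  have "dist a b = D"
    using nonneg by (simp add: a_def b_def dist_vec_def L2_set_def sum_2 dist_real_def)
  moreover have "dist b c = B"
  proof -
    have "(D - u)\<^sup>2 + v\<^sup>2 = B\<^sup>2" using v uD by (simp add: power2_diff)
    then show ?thesis
      using nonneg by (simp add: b_def c_def dist_vec_def L2_set_def sum_2 dist_real_def)
  qed
  moreover have "dist c a = A"
    using nonneg v by (simp add: a_def c_def dist_vec_def L2_set_def sum_2 dist_real_def)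
  ultimately show thesis using that by blast
qed

lemma dist_segment_point_power2:
  fixes a b c :: "'v::real_inner"
  shows "(dist c ((1 - t) *\<^sub>R a + t *\<^sub>R b))\<^sup>2 =
    (1 - t) * (dist c a)\<^sup>2 + t * (dist c b)\<^sup>2 - t * (1 - t) * (dist a b)\<^sup>2"
  unfolding dist_norm power2_norm_eq_inner
  by (simp add: inner_diff_left inner_diff_right inner_add_left inner_add_right inner_commute
      algebra_simps)

text \<open>The right-hand side is the squared distance from the apex to the corresponding point of the
  opposite side in the Euclidean comparison triangle.\<close>

lemma cat0_inequality:
  fixes p q z :: "'a::cat0_space"
  assumes \<gamma>: "geodesic_from_to p q \<gamma>" and t: "t \<in> {0..1}"
  shows "(dist z (\<gamma> t))\<^sup>2 \<le>
    (1 - t) * (dist z p)\<^sup>2 + t * (dist z q)\<^sup>2 - t * (1 - t) * (dist p q)\<^sup>2"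
proof -
  obtain a b c :: "real^2"
    where abc: "dist a b = dist p q" "dist b c = dist q z" "dist c a = dist z p"
    by (rule euclidean_comparison_triangle[of "dist z p" "dist q z" "dist p q"])
      (use dist_triangle[of z p q] dist_triangle[of q z p] dist_triangle[of p q z]
        in \<open>simp_all add: dist_commute\<close>)
  obtain \<beta> \<delta> where \<beta>: "geodesic_from_to q z \<beta>" and \<delta>: "geodesic_from_to z p \<delta>"
    using geodesic_exists by meson
  have z: "(z, c) \<in> comparison_pairs \<delta> c a"
    using \<delta> by (force simp: comparison_pairs_def geodesic_from_to_def image_iff)
  have \<gamma>t: "(\<gamma> t, (1 - t) *\<^sub>R a + t *\<^sub>R b) \<in> comparison_pairs \<gamma> a b"
    using t by (auto simp: comparison_pairs_def)
  have "dist z (\<gamma> t) \<le> dist c ((1 - t) *\<^sub>R a + t *\<^sub>R b)"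
    by (rule cat0_comparison[OF \<gamma> \<beta> \<delta> abc[symmetric] refl]) (use z \<gamma>t in auto)
  then have "(dist z (\<gamma> t))\<^sup>2 \<le> (dist c ((1 - t) *\<^sub>R a + t *\<^sub>R b))\<^sup>2"
    by (intro power_mono) auto
  also have "\<dots> = (1 - t) * (dist z p)\<^sup>2 + t * (dist z q)\<^sup>2 - t * (1 - t) * (dist p q)\<^sup>2"
    unfolding dist_segment_point_power2 using abc by (simp add: dist_commute)
  finally show ?thesis .
qed

section \<open>Nearest points of convex sets\<close>

lemma geodesically_convexD:
  assumes "geodesically_convex C" "p \<in> C" "q \<in> C" "geodesic_from_to p q \<gamma>" "t \<in> {0..1}"
  shows "\<gamma> t \<in> C"
  using assms unfolding geodesically_convex_def by blast

text \<open>A minimizing sequence in \<open>C\<close> is Cauchy: the midpoint of two almost nearest points lies in \<open>C\<close>,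
  and by the CAT(0) inequality it would be too close to \<open>z\<close> if the two points were far apart.\<close>

lemma nearest_point_of_closure_exists:
  fixes C :: "'a::hadamard_space set"
  assumes C: "geodesically_convex C" and "C \<noteq> {}"
  obtains p where "p \<in> closure C" "\<And>q. q \<in> C \<Longrightarrow> dist z p \<le> dist z q"
proof -
  define r where "r = infdist z C"
  have r0: "0 \<le> r" unfolding r_def by (rule infdist_nonneg)
  have r_le: "r\<^sup>2 \<le> (dist z q)\<^sup>2" if "q \<in> C" for q
    using infdist_le[OF that, of z] r0 unfolding r_def by (intro power_mono)
  have "\<exists>q\<in>C. (dist z q)\<^sup>2 < r\<^sup>2 + e" if "e > 0" for e
  proof -
    have "r < sqrt (r\<^sup>2 + e)" using that r0 by (intro real_less_rsqrt) auto
    then obtain q where "q \<in> C" "dist z q < sqrt (r\<^sup>2 + e)"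
      unfolding r_def infdist_notempty[OF \<open>C \<noteq> {}\<close>]
      using cInf_lessD[of "dist z ` C"] \<open>C \<noteq> {}\<close> by auto
    moreover from this have "(dist z q)\<^sup>2 < (sqrt (r\<^sup>2 + e))\<^sup>2"
      by (intro power_strict_mono) auto
    ultimately show ?thesis using that by (auto simp: add_nonneg_nonneg)
  qed
  then have "\<exists>q\<in>C. (dist z q)\<^sup>2 < r\<^sup>2 + inverse (Suc n)" for n by simp
  then obtain c where cC: "\<And>n. c n \<in> C"
    and c: "\<And>n. (dist z (c n))\<^sup>2 < r\<^sup>2 + inverse (Suc n)"
    by metis
  define e where "e n = inverse (real (Suc n))" for n
  have close: "(dist (c m) (c n))\<^sup>2 < 2 * e m + 2 * e n" for m n
  proof -
    obtain \<gamma> where \<gamma>: "geodesic_from_to (c m) (c n) \<gamma>" using geodesic_exists by blast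
    have "r\<^sup>2 \<le> (dist z (\<gamma> (1/2)))\<^sup>2"
      by (intro r_le geodesically_convexD[OF C cC cC \<gamma>]) simp
    also have "\<dots> \<le> (dist z (c m))\<^sup>2 / 2 + (dist z (c n))\<^sup>2 / 2 - (dist (c m) (c n))\<^sup>2 / 4"
      using cat0_inequality[OF \<gamma>, of "1/2" z] by simp
    finally show ?thesis using c[of m, folded e_def] c[of n, folded e_def] by linarith
  qed
  have "Cauchy c"
  proof (rule metric_CauchyI)
    fix d :: real assume "d > 0"
    then obtain M where M: "e M < d\<^sup>2 / 4"
      using reals_Archimedean[of "d\<^sup>2 / 4"] by (auto simp: e_def)
    have "dist (c m) (c n) < d" if "m \<ge> M" "n \<ge> M" for m n
    proof -
      have "e m \<le> e M" "e n \<le> e M"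
        unfolding e_def using that by (intro le_imp_inverse_le; simp)+
      then have "(dist (c m) (c n))\<^sup>2 < d\<^sup>2" using close[of m n] M by linarith
      then show ?thesis using \<open>d > 0\<close> power_less_imp_less_base[of _ 2 d] by simp
    qed
    then show "\<exists>M. \<forall>m\<ge>M. \<forall>n\<ge>M. dist (c m) (c n) < d" by blast
  qed
  then obtain p where p: "c \<longlonglongrightarrow> p" using Cauchy_convergent convergent_def by blast
  have lim: "(\<lambda>n. (dist z (c n))\<^sup>2) \<longlonglongrightarrow> (dist z p)\<^sup>2" by (intro tendsto_intros p)
  have "e \<longlonglongrightarrow> 0" unfolding e_def by (rule LIMSEQ_inverse_real_of_nat)
  then have lim': "(\<lambda>n. r\<^sup>2 + e n) \<longlonglongrightarrow> r\<^sup>2 + 0" by (intro tendsto_intros)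
  have "\<forall>n. (dist z (c n))\<^sup>2 \<le> r\<^sup>2 + e n"
    unfolding e_def by (intro allI less_imp_le[OF c])
  then have "(dist z p)\<^sup>2 \<le> r\<^sup>2 + 0" by (intro LIMSEQ_le[OF lim lim']) simp
  then have "dist z p \<le> r" using r0 power2_le_imp_le[of "dist z p" r] by simp
  then have "dist z p \<le> dist z q" if "q \<in> C" for q
    using infdist_le[OF that, of z] unfolding r_def by linarith
  moreover have "p \<in> closure C" using p cC closure_sequential by blast
  ultimately show thesis using that by blast
qed

text \<open>First variation: moving from \<open>p\<close> towards \<open>y\<close> inside the convex set cannot decrease the
  distance to \<open>z\<close>. As \<open>p\<close> may lie outside \<open>C\<close>, the geodesic starts at points of \<open>C\<close> that tend to
  \<open>p\<close>, and the limit is taken before the time \<open>t\<close> tends to \<open>0\<close>.\<close>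

lemma nearest_point_obtuse_angle:
  fixes C :: "'a::cat0_space set"
  assumes C: "geodesically_convex C" and p: "p \<in> closure C"
    and near: "\<And>q. q \<in> C \<Longrightarrow> dist z p \<le> dist z q" and y: "y \<in> C"
  shows "(dist z p)\<^sup>2 + (dist p y)\<^sup>2 \<le> (dist z y)\<^sup>2"
proof -
  obtain c where cC: "\<And>n. c n \<in> C" and c: "c \<longlonglongrightarrow> p"
    using p closure_sequential by metis
  have variation: "(dist z p)\<^sup>2 + (1 - t) * (dist p y)\<^sup>2 \<le> (dist z y)\<^sup>2" if t: "0 < t" "t \<le> 1" for t
  proof -
    let ?R = "\<lambda>q. (1 - t) * (dist z q)\<^sup>2 + t * (dist z y)\<^sup>2 - t * (1 - t) * (dist q y)\<^sup>2"
    have "(dist z p)\<^sup>2 \<le> ?R (c n)" for n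
    proof -
      obtain \<gamma> where \<gamma>: "geodesic_from_to (c n) y \<gamma>" using geodesic_exists by blast
      have "\<gamma> t \<in> C" using geodesically_convexD[OF C cC y \<gamma>] t by simp
      then have "(dist z p)\<^sup>2 \<le> (dist z (\<gamma> t))\<^sup>2" by (intro power_mono near) auto
      also have "\<dots> \<le> ?R (c n)" using cat0_inequality[OF \<gamma>] t by simp
      finally show ?thesis .
    qed
    moreover have "(\<lambda>n. ?R (c n)) \<longlonglongrightarrow> ?R p" by (intro tendsto_intros c)
    ultimately have "(dist z p)\<^sup>2 \<le> ?R p" by (intro LIMSEQ_le_const) auto
    then have "t * ((dist z p)\<^sup>2 + (1 - t) * (dist p y)\<^sup>2) \<le> t * (dist z y)\<^sup>2"
      by (simp add: algebra_simps)
    then show ?thesis using t by (simp only: mult_le_cancel_left_pos)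
  qed
  have "(\<lambda>n. (dist z p)\<^sup>2 + (1 - inverse (real (Suc n))) * (dist p y)\<^sup>2)
      \<longlonglongrightarrow> (dist z p)\<^sup>2 + (1 - 0) * (dist p y)\<^sup>2"
    by (intro tendsto_intros LIMSEQ_inverse_real_of_nat)
  then have "(dist z p)\<^sup>2 + (1 - 0) * (dist p y)\<^sup>2 \<le> (dist z y)\<^sup>2"
    by (rule LIMSEQ_le_const2) (intro exI allI impI variation; simp add: field_simps)
  then show ?thesis by simp
qed

section \<open>Projection onto a geodesic\<close>

lemma dist_geodesic_split:
  fixes \<gamma> :: "real \<Rightarrow> 'a::metric_space"
  assumes "geodesic_from_to l p \<gamma>" "t \<in> {0..1}"
  shows "dist l (\<gamma> t) + dist (\<gamma> t) p = dist l p"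
proof -
  have ends: "\<gamma> 0 = l" "\<gamma> 1 = p" and \<gamma>: "geodesic \<gamma>"
    using assms(1) by (simp_all add: geodesic_from_to_def)
  have "dist (\<gamma> 0) (\<gamma> t) = \<bar>0 - t\<bar> * dist l p" "dist (\<gamma> t) (\<gamma> 1) = \<bar>t - 1\<bar> * dist l p"
    using \<gamma>[unfolded geodesic_def ends] assms(2) by simp_all
  then show ?thesis using assms(2) by (simp add: ends algebra_simps)
qed

text \<open>At \<open>p\<close> the geodesic back to \<open>l\<close> makes an angle of at least \<open>\<pi>/2\<close> with every direction into the
  convex set, so that seen from \<open>C\<close> all other points of the geodesic lie behind its endpoint \<open>p\<close>.\<close>

lemma metric_proj_geodesic_to_nearest_point:
  fixes C :: "'a::cat0_space set"
  assumes C: "geodesically_convex C" and p: "p \<in> closure C"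
    and near: "\<And>q. q \<in> C \<Longrightarrow> dist l p \<le> dist l q"
    and \<gamma>: "geodesic_from_to l p \<gamma>" and y: "y \<in> C"
  shows "metric_proj (\<gamma> ` {0..1}) y = p"
proof -
  have obtuse: "(dist z p)\<^sup>2 + (dist y p)\<^sup>2 \<le> (dist y z)\<^sup>2" if "z \<in> \<gamma> ` {0..1}" for z
  proof -
    have "dist z p \<le> dist z q" if "q \<in> C" for q
      using dist_geodesic_split[OF \<gamma>] \<open>z \<in> \<gamma> ` {0..1}\<close> near[OF that] dist_triangle[of l q z]
      by force
    then show ?thesis
      using nearest_point_obtuse_angle[OF C p _ y, of z] by (simp add: dist_commute)
  qed
  have pS: "p \<in> \<gamma> ` {0..1}" using \<gamma> by (force simp: geodesic_from_to_def)
  have le: "dist y p \<le> dist y z" if "z \<in> \<gamma> ` {0..1}" for z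
  proof (rule power2_le_imp_le)
    show "(dist y p)\<^sup>2 \<le> (dist y z)\<^sup>2"
      using obtuse[OF that] zero_le_power2[of "dist z p"] by linarith
  qed simp
  show ?thesis
    unfolding metric_proj_def
  proof (rule the_equality)
    fix z assume z: "z \<in> \<gamma> ` {0..1} \<and> (\<forall>q\<in>\<gamma> ` {0..1}. dist y z \<le> dist y q)"
    then have "(dist y z)\<^sup>2 \<le> (dist y p)\<^sup>2" using pS by (intro power_mono) auto
    then have "(dist z p)\<^sup>2 \<le> 0" using obtuse[of z] z by linarith
    then show "z = p" by simp
  qed (use pS le in blast)
qed

section \<open>Mazur's lemma\<close>

lemma geodesically_convex_hull: "geodesically_convex (geodesically_convex hull S)"
proof (rule hull_in)
  fix T :: "'a set set"
  assume "Ball T geodesically_convex"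
  then show "geodesically_convex (\<Inter> T)"
    unfolding geodesically_convex_def by blast
qed

lemma geodesically_convex_Union_incseq:
  assumes mono: "incseq K" and K: "\<And>n. geodesically_convex (K n)"
  shows "geodesically_convex (\<Union>n. K n)"
  unfolding geodesically_convex_def
proof (intro ballI allI impI)
  fix p q \<gamma>
  assume "p \<in> (\<Union>n. K n)" "q \<in> (\<Union>n. K n)" and \<gamma>: "geodesic_from_to p q \<gamma>"
  then obtain m n where "p \<in> K m" "q \<in> K n" by blast
  then have "p \<in> K (max m n)" "q \<in> K (max m n)"
    using incseqD[OF mono, of m "max m n"] incseqD[OF mono, of n "max m n"] by auto
  then have "\<gamma> ` {0..1} \<subseteq> K (max m n)"
    using K \<gamma> unfolding geodesically_convex_def by blast
  then show "\<gamma> ` {0..1} \<subseteq> (\<Union>n. K n)" by blast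
qed

text \<open>A geodesic from \<open>l\<close> to its nearest point \<open>p\<close> is one of the test geodesics of weak convergence,
  and it detects a gap: the projections onto it are eventually constant equal to \<open>p\<close>.\<close>

lemma weak_limit_in_closure:
  fixes C :: "'a::hadamard_space set"
  assumes w: "weakly_converges x l" and C: "geodesically_convex C"
    and xC: "eventually (\<lambda>n. x n \<in> C) sequentially"
  shows "l \<in> closure C"
proof -
  have "C \<noteq> {}" using eventually_happens[OF xC] by auto
  then obtain p where p: "p \<in> closure C" "\<And>q. q \<in> C \<Longrightarrow> dist l p \<le> dist l q"
    using nearest_point_of_closure_exists[OF C] by blast
  obtain \<gamma> where \<gamma>: "geodesic_from_to l p \<gamma>" using geodesic_exists by blast
  then have "\<gamma> \<in> geodesics_from l" by (simp add: geodesics_from_def geodesic_from_to_def)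
  then have "(\<lambda>n. metric_proj (\<gamma> ` {0..1}) (x n)) \<longlonglongrightarrow> l"
    using w by (simp add: weakly_converges_def)
  moreover have "eventually (\<lambda>n. metric_proj (\<gamma> ` {0..1}) (x n) = p) sequentially"
    using xC by eventually_elim (rule metric_proj_geodesic_to_nearest_point[OF C p \<gamma>])
  ultimately have "(\<lambda>n. p) \<longlonglongrightarrow> l" by (rule Lim_transform_eventually)
  then have "p = l" by (simp add: LIMSEQ_const_iff)
  then show ?thesis using p by simp
qed

theorem theorem3:
  fixes x :: "nat \<Rightarrow> 'a::hadamard_space" and l :: 'a
  assumes "weakly_converges x l"
  shows "\<exists>(N :: nat \<Rightarrow> nat) (y :: nat \<Rightarrow> 'a).
           y \<longlonglongrightarrow> l \<and> (\<forall>n. y n \<in> geodesically_convex hull (x ` {1..N n}))"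
proof -
  define K where "K n = geodesically_convex hull (x ` {1..n})" for n
  have "incseq K"
    unfolding K_def incseq_def by (intro allI impI hull_mono image_mono) auto
  then have convex: "geodesically_convex (\<Union>n. K n)"
    by (rule geodesically_convex_Union_incseq) (simp add: K_def geodesically_convex_hull)
  have "x n \<in> (\<Union>n. K n)" if "n \<ge> 1" for n
    using that hull_subset[of "x ` {1..n}" geodesically_convex] unfolding K_def by force
  then have "eventually (\<lambda>n. x n \<in> (\<Union>n. K n)) sequentially"
    by (rule eventually_sequentiallyI)
  then have "l \<in> closure (\<Union>n. K n)"
    by (rule weak_limit_in_closure[OF assms convex])
  then obtain y where "\<And>n. y n \<in> (\<Union>n. K n)" and y: "y \<longlonglongrightarrow> l"
    unfolding closure_sequential by blast
  then have "\<forall>n. \<exists>m. y n \<in> K m" by blast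
  then obtain N where "\<And>n. y n \<in> K (N n)" by metis
  then show ?thesis using y unfolding K_def by blast
qed

end
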